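(* Let a linear switched system with modes $(A_i,B_i,C_i,D_i)$, $A_i\in\mathbb R^{n\times n}$, $B_i\in\mathbb R^{n\times m}$, $C_i\in\mathbb R^{p\times n}$, $D_i\in\mathbb R^{p\times m}$, $i=1,\dots,\ell$, be quadratic Lyapunov stable, i.e. there is $Q\in\mathbb R^{n\times n}$ with $Q=Q^T>0$ and $A_i^TQ+QA_i<0$ for all $i\in\{1,\dots,\ell\}$. For any $V\in\mathbb R^{n\times r}$ with full column rank, set $W=QV(V^TQV)^{-1}$. Then the reduced switched system with modes $(\widetilde A_i,\widetilde B_i,\widetilde C_i,\widetilde D_i)$, $i=1,\dots,\ell$, given by $$\widetilde A_i=(W^TV)^{-1}W^TA_iV,\quad \widetilde B_i=(W^TV)^{-1}W^TB_i,\quad \widetilde C_i=C_iV,\quad \widetilde D_i=D_i,$$ is quadratic Lyapunov stable.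
   Context: For a symmetric real matrix $X$, $X>0$ means positive definite and $X<0$ means negative definite. A linear switched system $\dot{\boldsymbol x}(t)=A_\sigma\boldsymbol x(t)+B_\sigma\boldsymbol u(t)$, $\boldsymbol y(t)=C_\sigma\boldsymbol x(t)+D_\sigma\boldsymbol u(t)$ with state matrices $A_1,\dots,A_\ell\in\mathbb R^{n\times n}$ is called quadratic Lyapunov stable if there exists a symmetric positive definite matrix $Q\in\mathbb R^{n\times n}$ such that $A_i^TQ+QA_i<0$ for all $i\in\{1,\dots,\ell\}$. For the reduced system the same definition is applied to the matrices $\widetilde A_1,\dots,\widetilde A_\ell\in\mathbb R^{r\times r}$. *)

theory Defs
  imports "HOL-Analysis.Analysis"
begin

definition pos_def :: "real ^ 'n ^ 'n \<Rightarrow> bool" where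
  "pos_def X \<longleftrightarrow> transpose X = X \<and> (\<forall>x. x \<noteq> 0 \<longrightarrow> x \<bullet> (X *v x) > 0)"

definition neg_def :: "real ^ 'n ^ 'n \<Rightarrow> bool" where
  "neg_def X \<longleftrightarrow> transpose X = X \<and> (\<forall>x. x \<noteq> 0 \<longrightarrow> x \<bullet> (X *v x) < 0)"

text \<open>
  A switched system with state, input and output dimensions \<open>CARD('n)\<close>, \<open>CARD('m)\<close> and
  \<open>CARD('p)\<close>. The modes are the indices \<open>1, \<dots>, num_modes\<close>; the values of the matrix families
  at other indices are irrelevant. Note that \<open>real ^ 'a ^ 'b\<close> has \<open>CARD('b)\<close> rows and
  \<open>CARD('a)\<close> columns.
\<close>

record ('n::finite, 'm::finite, 'p::finite) switched_system =
  num_modes :: nat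
  mat_A :: "nat \<Rightarrow> real ^ 'n ^ 'n"
  mat_B :: "nat \<Rightarrow> real ^ 'm ^ 'n"
  mat_C :: "nat \<Rightarrow> real ^ 'n ^ 'p"
  mat_D :: "nat \<Rightarrow> real ^ 'm ^ 'p"

definition lyapunov_matrix ::
    "('n::finite, 'm::finite, 'p::finite) switched_system \<Rightarrow> real ^ 'n ^ 'n \<Rightarrow> bool" where
  "lyapunov_matrix S Q \<longleftrightarrow> pos_def Q \<and>
     (\<forall>i \<in> {1..num_modes S}. neg_def (transpose (mat_A S i) ** Q + Q ** mat_A S i))"

definition quadratic_lyapunov_stable ::
    "('n::finite, 'm::finite, 'p::finite) switched_system \<Rightarrow> bool" where
  "quadratic_lyapunov_stable S \<longleftrightarrow> (\<exists>Q. lyapunov_matrix S Q)"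

text \<open>
  Petrov-Galerkin projection. The value is meaningful only if \<open>transpose W ** V\<close> is invertible,
  since \<^const>\<open>matrix_inv\<close> is unspecified on singular matrices.
\<close>

definition reduced_system ::
    "('n::finite, 'm::finite, 'p::finite) switched_system \<Rightarrow> real ^ 'r ^ 'n \<Rightarrow> real ^ 'r ^ 'n
     \<Rightarrow> ('r::finite, 'm, 'p) switched_system" where
  "reduced_system S W V =
     \<lparr> num_modes = num_modes S,
       mat_A = (\<lambda>i. matrix_inv (transpose W ** V) ** transpose W ** mat_A S i ** V),
       mat_B = (\<lambda>i. matrix_inv (transpose W ** V) ** transpose W ** mat_B S i),
       mat_C = (\<lambda>i. mat_C S i ** V),
       mat_D = mat_D S \<rparr>"

end

theory Submission
  imports Defs
begin

text \<open>
  The matrix \<open>M = V\<^sup>T Q V\<close> is positive definite, and \<open>W\<^sup>T V = I\<close>, so that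
  the reduced state matrices \<open>R\<^sub>i\<close> satisfy \<open>M R\<^sub>i = V\<^sup>T Q A\<^sub>i V\<close>. Hence
  \<open>R\<^sub>i\<^sup>T M + M R\<^sub>i = V\<^sup>T (A\<^sub>i\<^sup>T Q + Q A\<^sub>i) V\<close>,
  and \<open>M\<close> is a common Lyapunov matrix of the reduced system.
\<close>

lemma quadratic_form_congruence:
  fixes V :: "real ^ 'r ^ 'n"
  shows "x \<bullet> ((transpose V ** X ** V) *v x) = (V *v x) \<bullet> (X *v (V *v x))"
  by (metis dot_lmul_matrix inner_commute matrix_vector_mul_assoc transpose_matrix_vector)

lemma transpose_congruence:
  fixes V :: "real ^ 'r ^ 'n"
  assumes "transpose X = X"
  shows "transpose (transpose V ** X ** V) = transpose V ** X ** V"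
  using assms by (simp add: matrix_transpose_mul matrix_mul_assoc)

text \<open>Full column rank makes \<open>V\<close> injective, so a nonzero \<open>x\<close> has
  nonzero image \<open>V *v x\<close>, and the form of the congruence at \<open>x\<close> is that of
  \<open>X\<close> at this image.\<close>

lemma pos_def_congruence:
  fixes V :: "real ^ 'r::finite ^ 'n"
  assumes "pos_def X" "rank V = CARD('r)"
  shows "pos_def (transpose V ** X ** V)"
proof -
  have "V *v x \<noteq> 0" if "x \<noteq> 0" for x
    using assms(2) that by (metis full_rank_injective injD matrix_vector_mult_0_right)
  then show ?thesis
    using assms(1) by (simp add: pos_def_def transpose_congruence quadratic_form_congruence)
qed

lemma neg_def_congruence:
  fixes V :: "real ^ 'r::finite ^ 'n"
  assumes "neg_def X" "rank V = CARD('r)"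
  shows "neg_def (transpose V ** X ** V)"
proof -
  have "V *v x \<noteq> 0" if "x \<noteq> 0" for x
    using assms(2) that by (metis full_rank_injective injD matrix_vector_mult_0_right)
  then show ?thesis
    using assms(1) by (simp add: neg_def_def transpose_congruence quadratic_form_congruence)
qed

text \<open>A nonzero kernel vector would make the quadratic form vanish, so the kernel is trivial;
  for a square matrix this suffices.\<close>

lemma pos_def_invertible:
  assumes "pos_def X"
  shows "invertible X"
proof -
  have "X *v x \<noteq> 0" if "x \<noteq> 0" for x
    using assms that unfolding pos_def_def by (metis inner_zero_right less_irrefl)
  then show ?thesis
    by (metis invertible_left_inverse matrix_left_invertible_ker)
qed

lemma matrix_inv_right:
  fixes X :: "real ^ 'n ^ 'n"
  assumes "invertible X"
  shows "X ** matrix_inv X = mat 1"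
  using someI_ex[OF assms[unfolded invertible_def]] unfolding matrix_inv_def by (rule conjunct1)

lemma matrix_inv_left:
  fixes X :: "real ^ 'n ^ 'n"
  assumes "invertible X"
  shows "matrix_inv X ** X = mat 1"
  using matrix_inv_right[OF assms] by (simp add: matrix_left_right_inverse)

lemma matrix_add_rdistrib:
  "(B + C) ** A = B ** A + C ** A" for B C :: "real ^ 'n ^ 'm"
  by (simp add: matrix_matrix_mult_def vec_eq_iff distrib_right sum.distrib)

text \<open>Transposing \<open>X ** matrix_inv X = mat 1\<close> shows, by symmetry of
  \<open>X\<close>, that the transposed inverse is a left inverse of \<open>X\<close>; multiplying
  by \<open>matrix_inv X\<close> on the right identifies the two.\<close>

lemma transpose_matrix_inv_symmetric:
  fixes X :: "real ^ 'n ^ 'n"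
  assumes "invertible X" "transpose X = X"
  shows "transpose (matrix_inv X) = matrix_inv X"
proof -
  have "transpose (matrix_inv X) ** X = mat 1"
    using matrix_inv_right[OF assms(1)] assms(2)
    by (metis matrix_transpose_mul transpose_mat)
  then show ?thesis
    by (metis assms(1) matrix_inv_right matrix_mul_assoc matrix_mul_lid matrix_mul_rid)
qed

theorem theorem4p2:
  fixes S :: "('n::finite, 'm::finite, 'p::finite) switched_system"
    and Q :: "real ^ 'n ^ 'n"
    and V W :: "real ^ 'r::finite ^ 'n"
  assumes "lyapunov_matrix S Q"
    and "rank V = CARD('r)"
    and "W = Q ** V ** matrix_inv (transpose V ** Q ** V)"
  shows "quadratic_lyapunov_stable (reduced_system S W V)"
proof -
  define M where "M = transpose V ** Q ** V"
  have Q: "pos_def Q" "transpose Q = Q"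
    using assms(1) by (auto simp: lyapunov_matrix_def pos_def_def)
  have M: "pos_def M"
    unfolding M_def using Q(1) assms(2) by (rule pos_def_congruence)
  then have symM: "transpose M = M" and inv: "invertible M"
    by (auto simp: pos_def_def pos_def_invertible)
  have W: "transpose W = matrix_inv M ** transpose V ** Q"
    using transpose_matrix_inv_symmetric[OF inv symM]
    by (simp add: assms(3) M_def[symmetric] matrix_transpose_mul Q matrix_mul_assoc)
  have "transpose W ** V = mat 1"
    using matrix_inv_left[OF inv] by (simp add: W M_def matrix_mul_assoc)
  \<comment> \<open>This removes the factor \<open>matrix_inv (transpose W ** V)\<close> from the
    reduced state matrices.\<close>
  moreover have "matrix_inv (mat 1 :: real^'r^'r) = mat 1"
    by (metis invertible_def matrix_inv_right matrix_mul_lid)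
  ultimately have A: "mat_A (reduced_system S W V) i = transpose W ** mat_A S i ** V" for i
    by (simp add: reduced_system_def)
  \<comment> \<open>The factor \<open>M\<close> cancels the \<open>matrix_inv M\<close> at the left
    end of \<open>transpose W\<close>.\<close>
  have MA: "M ** mat_A (reduced_system S W V) i = transpose V ** Q ** mat_A S i ** V" for i
    by (simp add: A W matrix_mul_assoc matrix_inv_right[OF inv])
  \<comment> \<open>The transpose of \<open>MA\<close>, using the symmetry of \<open>M\<close> and
    \<open>Q\<close>.\<close>
  have AM: "transpose (mat_A (reduced_system S W V) i) ** M
      = transpose V ** transpose (mat_A S i) ** Q ** V" for i
    using arg_cong[OF MA[of i], of transpose]
    by (simp add: matrix_transpose_mul symM Q matrix_mul_assoc)
  have "transpose (mat_A (reduced_system S W V) i) ** M + M ** mat_A (reduced_system S W V) i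
      = transpose V ** (transpose (mat_A S i) ** Q + Q ** mat_A S i) ** V" for i
    by (simp add: MA AM matrix_add_ldistrib matrix_add_rdistrib matrix_mul_assoc)
  moreover have "num_modes (reduced_system S W V) = num_modes S"
    by (simp add: reduced_system_def)
  \<comment> \<open>Each Lyapunov expression is now a congruence by \<open>V\<close> of a negative
    definite matrix, for the same range of modes.\<close>
  ultimately have "lyapunov_matrix (reduced_system S W V) M"
    using M assms(1,2) by (simp add: lyapunov_matrix_def neg_def_congruence)
  then show ?thesis
    by (auto simp: quadratic_lyapunov_stable_def)
qed

end
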